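(* Let $g\neq0$ be a function on $\partial V$ satisfying $\sum_{i\in\partial V}g_i=0$ and let $a=(a_{ij})_{n\times n}$ be a measurement matrix. Consider the least gradient problem $$(\ast)\qquad \min_{u\in\mathcal{M}_g}\ \tfrac12\sum_{i,j}a_{ij}|u_i-u_j|,\qquad \mathcal{M}_g=\Big\{u\in\mathbb{R}^n:\sum_{i\in\partial V}u_ig_i=1\Big\}.$$ If $v\in\mathcal{V}_{(g,a)}$, then $v$ is a minimizer of $(\ast)$. Conversely, given any $a=(a_{ij})$ with $a_{ij}\ge0$ and any $g\in\mathbb{R}^{|\partial V|}$ satisfying $\sum_{i\in\partial V}g_i=0$, if $v$ is a minimizer of $(\ast)$, then $v\in\mathcal{V}_{(\lambda g,a)}$ for some $\lambda>0$.
   Context: $G=(V,E)$ is a simple, undirected, connected graph with vertex set $V=\{1,\dots,n\}$; $\partial V\subset V$ is a set of boundary vertices and $\mathrm{int}(V)=V\setminus\partial V$. Throughout, $a$ denotes a measurement matrix, that is, a symmetric $n\times n$ matrix $a=(a_{ij})$ with $a_{ij}\in[0,\infty)$ for all $1\le i,j\le n$ and $a_{ij}=0$ whenever $i=j$ or $\{i,j\}\notin E$. A current is a real $n\times n$ matrix $J=(J_{ij})$ with $J_{ij}=-J_{ji}$, $J_{ii}=0$, and $J_{ij}=0$ whenever $\{i,j\}\notin E$. Given $0\neq h:\partial V\to\mathbb{R}$ with $\sum_{i\in\partial V}h_i=0$ and a measurement matrix $a$, a symmetric matrix $\sigma=(\sigma_{ij})_{n\times n}$ with $\sigma_{ij}\in[0,\infty]$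 is a conductivity matrix associated to the data $(h,a)$ if there exist a function $v:\{1,\dots,n\}\to\mathbb{R}$ and a current $J=(J_{ij})$ such that $$J_{ij}=\sigma_{ij}(v_i-v_j)\ \text{ and }\ |J_{ij}|=a_{ij}\quad\text{for all } i,j \text{ with } v_i\neq v_j,$$ $\sum_{j=1}^nJ_{ij}=h_i$ for all $i\in\partial V$, and $\sum_{j=1}^nJ_{ij}=0$ for all $i\in\mathrm{int}(V)$. When $a_{ij}\neq0$ and $v_i=v_j$, one formally sets $\sigma_{ij}=\infty$ and says that the edge between $i$ and $j$ is a perfect conductor. Such a function $v$ is called a voltage potential, and $\mathcal{V}_{(h,a)}$ denotes the set of all voltage potentials corresponding to the data $(h,a)$ ($h$ is the injected current).
   Formalization: Corrected: the definition of voltage potential also requires |J_ij| ≤ a_ij where v_i = v_j; the first part says that every multiple cv of v lying in M_g is a minimizer; the converse assumes that the minimum of (∗) is positive. *)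

theory Defs
  imports "HOL-Analysis.Analysis"
begin

text \<open>The vertex set is the finite index type \<open>'n\<close>; edges are two-element sets of vertices.
  The boundary is an arbitrary vertex set \<open>B\<close>; boundary functions are only evaluated on \<open>B\<close>.\<close>

definition simple_connected_graph :: "'n::finite set set \<Rightarrow> bool" where
  "simple_connected_graph E \<longleftrightarrow>
     (\<forall>e\<in>E. \<exists>i j. i \<noteq> j \<and> e = {i, j}) \<and>
     (\<forall>i j. (i, j) \<in> {(x, y). {x, y} \<in> E}\<^sup>*)"

definition measurement_matrix :: "'n::finite set set \<Rightarrow> real^'n^'n \<Rightarrow> bool" where
  "measurement_matrix E a \<longleftrightarrow>
     (\<forall>i j. a $ i $ j = a $ j $ i) \<and>
     (\<forall>i j. 0 \<le> a $ i $ j) \<and>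
     (\<forall>i j. i = j \<or> {i, j} \<notin> E \<longrightarrow> a $ i $ j = 0)"

definition current :: "'n::finite set set \<Rightarrow> real^'n^'n \<Rightarrow> bool" where
  "current E J \<longleftrightarrow>
     (\<forall>i j. J $ i $ j = - (J $ j $ i)) \<and>
     (\<forall>i. J $ i $ i = 0) \<and>
     (\<forall>i j. {i, j} \<notin> E \<longrightarrow> J $ i $ j = 0)"

text \<open>
  Ohm's law is stated in the extended reals: since \<open>J\<close> is real, it forces \<open>\<sigma>\<close> to be finite
  wherever the voltage differs.

  Where the voltages agree, Ohm's law leaves \<open>J\<close> undetermined on a perfect conductor.
  The bound \<open>\<bar>J\<bar> \<le> a\<close> there makes \<open>a\<close> the capacity of such an edge (and \<open>J = 0\<close> if \<open>a = 0\<close>).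
  Without it the data \<open>a\<close> would not restrict \<open>J\<close> on these edges at all, and a voltage potential
  need not minimize the energy: on the path 1 - 2 - 3 with \<open>a\<^sub>1\<^sub>2 = 1\<close>, \<open>a\<^sub>2\<^sub>3 = 1/2\<close>
  and boundary data \<open>1, -1\<close> at the ends, \<open>v = (1, 0, 0)\<close> with unit current has energy 1,
  whereas \<open>(1, 1, 0)\<close> has energy 1/2.
\<close>

definition conductivity_solution ::
  "'n::finite set set \<Rightarrow> 'n set \<Rightarrow> ('n \<Rightarrow> real) \<Rightarrow> real^'n^'n \<Rightarrow>
   ereal^'n^'n \<Rightarrow> real^'n \<Rightarrow> real^'n^'n \<Rightarrow> bool" where
  "conductivity_solution E B h a \<sigma> v J \<longleftrightarrow>
     (\<forall>i j. \<sigma> $ i $ j = \<sigma> $ j $ i) \<and>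
     (\<forall>i j. 0 \<le> \<sigma> $ i $ j) \<and>
     current E J \<and>
     (\<forall>i j. v $ i \<noteq> v $ j \<longrightarrow>
        ereal (J $ i $ j) = \<sigma> $ i $ j * ereal (v $ i - v $ j) \<and> \<bar>J $ i $ j\<bar> = a $ i $ j) \<and>
     (\<forall>i j. v $ i = v $ j \<longrightarrow> \<bar>J $ i $ j\<bar> \<le> a $ i $ j) \<and>
     (\<forall>i j. v $ i = v $ j \<and> a $ i $ j \<noteq> 0 \<longrightarrow> \<sigma> $ i $ j = \<infinity>) \<and>
     (\<forall>i\<in>B. (\<Sum>j\<in>UNIV. J $ i $ j) = h i) \<and>
     (\<forall>i\<in>- B. (\<Sum>j\<in>UNIV. J $ i $ j) = 0)"

definition voltage_potentials ::
  "'n::finite set set \<Rightarrow> 'n set \<Rightarrow> ('n \<Rightarrow> real) \<Rightarrow> real^'n^'n \<Rightarrow> (real^'n) set" where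
  "voltage_potentials E B h a = {v. \<exists>\<sigma> J. conductivity_solution E B h a \<sigma> v J}"

definition weighted_variation :: "real^'n^'n \<Rightarrow> real^'n::finite \<Rightarrow> real" where
  "weighted_variation a u =
     (1/2) * (\<Sum>i\<in>UNIV. \<Sum>j\<in>UNIV. a $ i $ j * \<bar>u $ i - u $ j\<bar>)"

definition feasible_potentials :: "'n::finite set \<Rightarrow> ('n \<Rightarrow> real) \<Rightarrow> (real^'n) set" where
  "feasible_potentials B g = {u. (\<Sum>i\<in>B. u $ i * g i) = 1}"

definition least_gradient_minimizer ::
  "'n::finite set \<Rightarrow> ('n \<Rightarrow> real) \<Rightarrow> real^'n^'n \<Rightarrow> real^'n \<Rightarrow> bool" where
  "least_gradient_minimizer B g a v \<longleftrightarrow>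
     is_arg_min (weighted_variation a) (\<lambda>u. u \<in> feasible_potentials B g) v"

end

theory Submission
  imports Defs
begin

text \<open>
  Call an antisymmetric matrix \<open>J\<close> with \<open>\<bar>J\<bar> \<le> a\<close> an admissible flow.  The energy
  \<open>F(u) = 1/2 \<Sum> a\<^sub>i\<^sub>j \<bar>u\<^sub>i - u\<^sub>j\<bar>\<close> is the support function of the compact convex set of
  divergences of admissible flows: summation by parts gives
  \<open>u \<bullet> div J = 1/2 \<Sum> J\<^sub>i\<^sub>j (u\<^sub>i - u\<^sub>j) \<le> F(u)\<close>, with equality exactly when the flow is
  saturated and runs from higher to lower potential wherever \<open>u\<close> differs.  This equality
  condition is precisely Ohm's law together with \<open>\<bar>J\<bar> = a\<close>.

  If \<open>v\<close> is a voltage potential with current \<open>J\<close> and \<open>div J = g\<close>, then \<open>J\<close> calibrates \<open>v\<close>: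
  every feasible \<open>u\<close> has \<open>F(u) \<ge> u \<bullet> g = 1\<close>, while \<open>F(v) = v \<bullet> g\<close>, so the multiple of \<open>v\<close>
  normalized to \<open>v \<bullet> g = 1\<close> has energy \<open>1\<close>.

  Conversely let \<open>v\<close> be a minimizer with energy \<open>m > 0\<close>.  By homogeneity
  \<open>u \<bullet> (m g) \<le> F(u)\<close> for all \<open>u\<close>, so hyperplane separation (a max-flow min-cut duality,
  lemma \<open>divergence_of_admissible_flow_iff\<close>) yields an admissible flow \<open>J\<close> with
  \<open>div J = m g\<close>.  Since \<open>v \<bullet> (m g) = m = F(v)\<close>, this flow attains equality at \<open>v\<close>, and
  \<open>\<sigma>\<^sub>i\<^sub>j = a\<^sub>i\<^sub>j / \<bar>v\<^sub>i - v\<^sub>j\<bar>\<close> is the required conductivity, for the scaling factor \<open>m\<close>.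
\<close>

definition divergence :: "real^'n^'n \<Rightarrow> real^'n::finite" where
  "divergence J = (\<chi> i. \<Sum>j\<in>UNIV. J $ i $ j)"

definition admissible_flows :: "real^'n^'n \<Rightarrow> (real^'n^'n::finite) set" where
  "admissible_flows a = {J. (\<forall>i j. J $ i $ j = - (J $ j $ i)) \<and> (\<forall>i j. \<bar>J $ i $ j\<bar> \<le> a $ i $ j)}"

lemma admissible_flows_antisym: "J \<in> admissible_flows a \<Longrightarrow> J $ i $ j = - (J $ j $ i)"
  and admissible_flows_bound: "J \<in> admissible_flows a \<Longrightarrow> \<bar>J $ i $ j\<bar> \<le> a $ i $ j"
  unfolding admissible_flows_def by blast+

definition extend_by_zero :: "'n::finite set \<Rightarrow> ('n \<Rightarrow> real) \<Rightarrow> real^'n" where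
  "extend_by_zero B g = (\<chi> i. if i \<in> B then g i else 0)"

lemma inner_extend_by_zero: "u \<bullet> extend_by_zero B g = (\<Sum>i\<in>B. u $ i * g i)"
  by (simp add: extend_by_zero_def inner_vec_def if_distrib[of "(*) _"] sum.If_cases)

lemma extend_by_zero_scale: "extend_by_zero B (\<lambda>i. l * g i) = l *\<^sub>R extend_by_zero B g"
  by (simp add: extend_by_zero_def vec_eq_iff)

lemma divergence_eq_extend_by_zero_iff:
  "divergence J = extend_by_zero B h \<longleftrightarrow>
     (\<forall>i\<in>B. (\<Sum>j\<in>UNIV. J $ i $ j) = h i) \<and> (\<forall>i\<in>- B. (\<Sum>j\<in>UNIV. J $ i $ j) = 0)"
  by (auto simp: divergence_def extend_by_zero_def vec_eq_iff)

lemma weighted_variation_scale: "weighted_variation a (c *\<^sub>R u) = \<bar>c\<bar> * weighted_variation a u"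
  by (simp add: weighted_variation_def sum_distrib_left abs_mult mult_ac
      flip: right_diff_distrib)

section \<open>Flows and the energy\<close>

lemma inner_divergence:
  fixes J :: "real^'n^'n::finite"
  assumes "\<And>i j. J $ i $ j = - (J $ j $ i)"
  shows "u \<bullet> divergence J = (1/2) * (\<Sum>i\<in>UNIV. \<Sum>j\<in>UNIV. J $ i $ j * (u $ i - u $ j))"
proof -
  have "(\<Sum>i\<in>UNIV. \<Sum>j\<in>UNIV. J $ i $ j * u $ j) = (\<Sum>i\<in>UNIV. \<Sum>j\<in>UNIV. J $ j $ i * u $ i)"
    by (rule sum.swap)
  also have "\<dots> = (\<Sum>i\<in>UNIV. \<Sum>j\<in>UNIV. - (J $ i $ j * u $ i))"
    by (intro sum.cong refl) (metis assms mult_minus_left)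
  also have "\<dots> = - (\<Sum>i\<in>UNIV. \<Sum>j\<in>UNIV. J $ i $ j * u $ i)"
    by (simp add: sum_negf)
  finally show ?thesis
    by (simp add: divergence_def inner_vec_def sum_distrib_left right_diff_distrib sum_subtractf
        mult.commute)
qed

text \<open>
  The energy defect of a flow is a sum of nonnegative edge terms; it is this form that lets
  equality of the totals be read off edge by edge.
\<close>

lemma energy_defect:
  fixes J :: "real^'n^'n::finite"
  assumes "\<And>i j. J $ i $ j = - (J $ j $ i)"
  shows "weighted_variation a u - u \<bullet> divergence J =
    (1/2) * (\<Sum>i\<in>UNIV. \<Sum>j\<in>UNIV. a $ i $ j * \<bar>u $ i - u $ j\<bar> - J $ i $ j * (u $ i - u $ j))"
  by (simp add: weighted_variation_def inner_divergence[OF assms] sum_subtractf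
      right_diff_distrib)

lemma edge_defect_nonneg:
  assumes "\<bar>x\<bar> \<le> (y::real)"
  shows "0 \<le> y * \<bar>d\<bar> - x * d"
proof -
  have "x * d \<le> \<bar>x\<bar> * \<bar>d\<bar>" by (metis abs_ge_self abs_mult)
  also have "\<dots> \<le> y * \<bar>d\<bar>" using assms by (simp add: mult_right_mono)
  finally show ?thesis by simp
qed

lemma inner_divergence_le:
  assumes "J \<in> admissible_flows a"
  shows "u \<bullet> divergence J \<le> weighted_variation a u"
proof -
  note anti = admissible_flows_antisym[OF assms] and le = admissible_flows_bound[OF assms]
  have "0 \<le> weighted_variation a u - u \<bullet> divergence J"
    unfolding energy_defect[OF anti]
    by (intro mult_nonneg_nonneg sum_nonneg edge_defect_nonneg le) simp
  then show ?thesis by simp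
qed

lemma inner_divergence_eq_iff:
  assumes "J \<in> admissible_flows a"
  shows "u \<bullet> divergence J = weighted_variation a u \<longleftrightarrow>
    (\<forall>i j. J $ i $ j * (u $ i - u $ j) = a $ i $ j * \<bar>u $ i - u $ j\<bar>)" (is "_ \<longleftrightarrow> ?rhs")
proof -
  note anti = admissible_flows_antisym[OF assms] and le = admissible_flows_bound[OF assms]
  let ?d = "\<lambda>i j. a $ i $ j * \<bar>u $ i - u $ j\<bar> - J $ i $ j * (u $ i - u $ j)"
  have nonneg: "0 \<le> ?d i j" for i j
    by (rule edge_defect_nonneg[OF le])
  have "u \<bullet> divergence J = weighted_variation a u \<longleftrightarrow>
      weighted_variation a u - u \<bullet> divergence J = 0" by auto
  also have "\<dots> \<longleftrightarrow> (\<Sum>i\<in>UNIV. \<Sum>j\<in>UNIV. ?d i j) = 0"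
    unfolding energy_defect[OF anti] by simp
  also have "\<dots> \<longleftrightarrow> (\<forall>i. (\<Sum>j\<in>UNIV. ?d i j) = 0)"
    using sum_nonneg_eq_0_iff[of UNIV "\<lambda>i. \<Sum>j\<in>UNIV. ?d i j", OF finite sum_nonneg, OF nonneg]
    by simp
  also have "\<dots> \<longleftrightarrow> (\<forall>i j. ?d i j = 0)"
    using sum_nonneg_eq_0_iff[of UNIV "?d i" for i, OF finite nonneg] by simp
  also have "\<dots> \<longleftrightarrow> ?rhs"
    unfolding right_minus_eq by (simp only: eq_commute)
  finally show ?thesis .
qed

section \<open>Duality\<close>

lemma linear_divergence: "linear divergence"
  by (rule linearI) (simp_all add: divergence_def vec_eq_iff sum.distrib sum_distrib_left)

lemma convex_admissible_flows: "convex (admissible_flows (a :: real^'n^'n::finite))"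
proof (rule convexI)
  fix J K :: "real^'n^'n" and s t :: real
  assume JK: "J \<in> admissible_flows a" "K \<in> admissible_flows a"
    and st: "0 \<le> s" "0 \<le> t" "s + t = 1"
  have "\<bar>s * J $ i $ j + t * K $ i $ j\<bar> \<le> a $ i $ j" for i j
  proof -
    have "\<bar>s * J $ i $ j + t * K $ i $ j\<bar> \<le> s * \<bar>J $ i $ j\<bar> + t * \<bar>K $ i $ j\<bar>"
      using st by (metis abs_mult abs_of_nonneg abs_triangle_ineq)
    also have "\<dots> \<le> a $ i $ j"
      using JK st by (intro convex_bound_le admissible_flows_bound)
    finally show ?thesis .
  qed
  moreover have "s * J $ i $ j + t * K $ i $ j = - (s * J $ j $ i + t * K $ j $ i)" for i j
  proof -
    have "J $ i $ j = - (J $ j $ i)" "K $ i $ j = - (K $ j $ i)"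
      using JK by (blast intro: admissible_flows_antisym)+
    then show ?thesis by simp
  qed
  ultimately show "s *\<^sub>R J + t *\<^sub>R K \<in> admissible_flows a"
    unfolding admissible_flows_def mem_Collect_eq vector_add_component vector_scaleR_component
      real_scaleR_def by blast
qed

lemma compact_admissible_flows: "compact (admissible_flows (a :: real^'n^'n::finite))"
proof -
  have "norm J \<le> (\<Sum>i\<in>UNIV. \<Sum>j\<in>UNIV. a $ i $ j)" if "J \<in> admissible_flows a" for J
  proof -
    have "norm J \<le> (\<Sum>i\<in>UNIV. norm (J $ i))"
      unfolding norm_vec_def by (rule L2_set_le_sum) simp
    also have "\<dots> \<le> (\<Sum>i\<in>UNIV. \<Sum>j\<in>UNIV. \<bar>J $ i $ j\<bar>)"
      by (intro sum_mono norm_le_l1_cart)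
    also have "\<dots> \<le> (\<Sum>i\<in>UNIV. \<Sum>j\<in>UNIV. a $ i $ j)"
      using that by (intro sum_mono admissible_flows_bound)
    finally show ?thesis .
  qed
  then have "bounded (admissible_flows a)" by (auto simp: bounded_iff)
  moreover have "closed (admissible_flows a)"
    unfolding admissible_flows_def
    by (intro closed_Collect_conj closed_Collect_all closed_Collect_eq closed_Collect_le
        continuous_intros)
  ultimately show ?thesis by (simp add: compact_eq_bounded_closed)
qed

text \<open>
  The support function of the divergences is attained: send full capacity down the potential
  on every edge.
\<close>

lemma ex_saturating_flow:
  fixes a :: "real^'n^'n::finite"
  assumes sym: "\<And>i j. a $ i $ j = a $ j $ i" and nonneg: "\<And>i j. 0 \<le> a $ i $ j"
  shows "\<exists>J\<in>admissible_flows a. u \<bullet> divergence J = weighted_variation a u"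
proof -
  define J :: "real^'n^'n" where "J = (\<chi> i j. a $ i $ j * sgn (u $ i - u $ j))"
  have anti: "J $ i $ j = - (J $ j $ i)" for i j
    using sym[of i j] sgn_minus[of "u $ i - u $ j"] by (simp add: J_def)
  have "\<bar>J $ i $ j\<bar> \<le> a $ i $ j" for i j
    using nonneg[of i j] by (simp add: J_def abs_mult sgn_if)
  then have J: "J \<in> admissible_flows a"
    unfolding admissible_flows_def using anti by blast
  have "J $ i $ j * (u $ i - u $ j) = a $ i $ j * \<bar>u $ i - u $ j\<bar>" for i j
    by (simp add: J_def abs_sgn mult_ac)
  with J show ?thesis using inner_divergence_eq_iff by blast
qed

text \<open>
  A compact convex set is determined by its support function: a source \<open>w\<close> that no admissible
  flow realises is separated from all realisable ones by some \<open>u\<close>, and the flow saturating the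
  capacities along \<open>u\<close> shows that this \<open>u\<close> violates the energy bound.
\<close>

lemma divergence_of_admissible_flow_iff:
  fixes a :: "real^'n^'n::finite"
  assumes sym: "\<And>i j. a $ i $ j = a $ j $ i" and nonneg: "\<And>i j. 0 \<le> a $ i $ j"
  shows "w \<in> divergence ` admissible_flows a \<longleftrightarrow> (\<forall>u. u \<bullet> w \<le> weighted_variation a u)"
proof
  assume "w \<in> divergence ` admissible_flows a"
  then show "\<forall>u. u \<bullet> w \<le> weighted_variation a u" by (auto intro: inner_divergence_le)
next
  assume bound: "\<forall>u. u \<bullet> w \<le> weighted_variation a u"
  show "w \<in> divergence ` admissible_flows a"
  proof (rule ccontr)
    assume notin: "w \<notin> divergence ` admissible_flows a"
    have "convex (divergence ` admissible_flows a)"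
      by (rule convex_linear_image[OF linear_divergence convex_admissible_flows])
    moreover have "closed (divergence ` admissible_flows a)"
      by (intro compact_imp_closed compact_continuous_image compact_admissible_flows
          linear_continuous_on linear_conv_bounded_linear[THEN iffD1] linear_divergence)
    ultimately obtain p b where p: "p \<bullet> w < b"
      and above: "\<And>J. J \<in> admissible_flows a \<Longrightarrow> b < p \<bullet> divergence J"
      using separating_hyperplane_closed_point[OF _ _ notin] by (metis imageI)
    obtain J where "J \<in> admissible_flows a" "(- p) \<bullet> divergence J = weighted_variation a (- p)"
      using ex_saturating_flow[OF sym nonneg] by blast
    then have "weighted_variation a (- p) < (- p) \<bullet> w"
      using above[of J] p by simp
    with bound show False by (meson not_le)
  qed
qed

section \<open>Voltage potentials as calibrated potentials\<close>

text \<open>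
  Since the conductivity is a free unknown, Ohm's law on an edge with a voltage drop only fixes
  the direction of the current, and \<open>\<bar>J\<bar> = a\<close> its size; together they are the equality case of the energy bound.  So
  \<open>\<sigma>\<close> can be eliminated.
\<close>

lemma voltage_potentials_iff:
  fixes a :: "real^'n^'n::finite"
  assumes a: "measurement_matrix E a"
  shows "v \<in> voltage_potentials E B h a \<longleftrightarrow>
    (\<exists>J\<in>admissible_flows a. divergence J = extend_by_zero B h \<and>
       v \<bullet> divergence J = weighted_variation a v)"
proof
  assume "v \<in> voltage_potentials E B h a"
  then obtain \<sigma> J where sol: "conductivity_solution E B h a \<sigma> v J"
    by (auto simp: voltage_potentials_def)
  then have div: "divergence J = extend_by_zero B h"
    by (auto simp: divergence_eq_extend_by_zero_iff conductivity_solution_def)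
  have "\<bar>J $ i $ j\<bar> \<le> a $ i $ j" for i j
    using sol unfolding conductivity_solution_def by (metis order_refl)
  then have J: "J \<in> admissible_flows a"
    using sol unfolding admissible_flows_def conductivity_solution_def current_def by blast
  have "J $ i $ j * (v $ i - v $ j) = a $ i $ j * \<bar>v $ i - v $ j\<bar>" for i j
  proof (cases "v $ i = v $ j")
    case False
    then have ohm: "ereal (J $ i $ j) = \<sigma> $ i $ j * ereal (v $ i - v $ j)"
      and abs: "\<bar>J $ i $ j\<bar> = a $ i $ j" and nonneg: "0 \<le> \<sigma> $ i $ j"
      using sol unfolding conductivity_solution_def by blast+
    \<comment> \<open>An infinite conductivity across a voltage drop would make the real current infinite.\<close>
    from ohm nonneg False obtain s where "\<sigma> $ i $ j = ereal s"
      by (cases "\<sigma> $ i $ j") (auto split: if_splits)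
    with ohm nonneg have "J $ i $ j = s * (v $ i - v $ j)" "0 \<le> s" by auto
    then have "0 \<le> J $ i $ j * (v $ i - v $ j)" by (simp add: mult.assoc)
    then show ?thesis by (metis abs abs_mult abs_of_nonneg)
  qed simp
  with J div show "\<exists>J\<in>admissible_flows a. divergence J = extend_by_zero B h \<and>
       v \<bullet> divergence J = weighted_variation a v"
    using inner_divergence_eq_iff by blast
next
  assume "\<exists>J\<in>admissible_flows a. divergence J = extend_by_zero B h \<and>
       v \<bullet> divergence J = weighted_variation a v"
  then obtain J where J: "J \<in> admissible_flows a" and div: "divergence J = extend_by_zero B h"
    and sat: "\<And>i j. J $ i $ j * (v $ i - v $ j) = a $ i $ j * \<bar>v $ i - v $ j\<bar>"
    using inner_divergence_eq_iff by blast
  note anti = admissible_flows_antisym[OF J] and le = admissible_flows_bound[OF J]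
  have sym: "a $ i $ j = a $ j $ i" and nonneg: "0 \<le> a $ i $ j"
    and zero: "i = j \<or> {i, j} \<notin> E \<Longrightarrow> a $ i $ j = 0" for i j
    using a unfolding measurement_matrix_def by blast+
  define \<sigma> :: "ereal^'n^'n" where
    "\<sigma> = (\<chi> i j. if v $ i = v $ j then (if a $ i $ j = 0 then 0 else \<infinity>)
                 else ereal (a $ i $ j / \<bar>v $ i - v $ j\<bar>))"
  have ohm: "J $ i $ j = a $ i $ j / \<bar>v $ i - v $ j\<bar> * (v $ i - v $ j)" if "v $ i \<noteq> v $ j" for i j
  proof -
    have "J $ i $ j = a $ i $ j * \<bar>v $ i - v $ j\<bar> / (v $ i - v $ j)"
      using sat[of i j] that by (simp add: eq_divide_eq)
    also have "\<dots> = a $ i $ j * (v $ i - v $ j) / \<bar>v $ i - v $ j\<bar>"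
      using that by (simp add: frac_eq_eq mult.assoc)
    finally show ?thesis by simp
  qed
  have cur: "current E J"
    unfolding current_def using anti le zero by (metis abs_le_zero_iff)
  have "conductivity_solution E B h a \<sigma> v J"
    unfolding conductivity_solution_def
  proof (intro conjI allI impI)
    fix i j
    show "\<sigma> $ i $ j = \<sigma> $ j $ i" "0 \<le> \<sigma> $ i $ j"
      using sym[of i j] nonneg[of i j] by (auto simp: \<sigma>_def abs_minus_commute[of "v $ i"])
    show "\<bar>J $ i $ j\<bar> \<le> a $ i $ j" by (rule le)
    show "\<sigma> $ i $ j = \<infinity>" if "v $ i = v $ j \<and> a $ i $ j \<noteq> 0"
      using that by (simp add: \<sigma>_def)
    assume neq: "v $ i \<noteq> v $ j"
    show "ereal (J $ i $ j) = \<sigma> $ i $ j * ereal (v $ i - v $ j)"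
      using neq ohm[OF neq] by (simp add: \<sigma>_def)
    show "\<bar>J $ i $ j\<bar> = a $ i $ j"
      using neq nonneg[of i j] by (simp add: ohm[OF neq] abs_mult)
  qed (use cur div in \<open>auto simp: divergence_eq_extend_by_zero_iff\<close>)
  then show "v \<in> voltage_potentials E B h a" by (auto simp: voltage_potentials_def)
qed

section \<open>The least gradient problem\<close>

lemma least_gradient_minimizer_iff:
  "least_gradient_minimizer B g a v \<longleftrightarrow> v \<bullet> extend_by_zero B g = 1 \<and>
     (\<forall>u. u \<bullet> extend_by_zero B g = 1 \<longrightarrow> weighted_variation a v \<le> weighted_variation a u)"
  by (auto simp: least_gradient_minimizer_def is_arg_min_linorder feasible_potentials_def
      inner_extend_by_zero)

text \<open>
  The current of \<open>v\<close> certifies minimality.  The energy of \<open>v\<close> equals \<open>v \<bullet> g\<close>, so this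
  pairing is nonnegative and the normalizing factor \<open>c\<close> must be positive.
\<close>

lemma normalized_voltage_potential_is_minimizer:
  assumes "measurement_matrix E a" and "v \<in> voltage_potentials E B g a"
    and feas: "(c *\<^sub>R v) \<bullet> extend_by_zero B g = 1"
  shows "least_gradient_minimizer B g a (c *\<^sub>R v)"
proof -
  obtain J where J: "J \<in> admissible_flows a" and div: "divergence J = extend_by_zero B g"
    and eq: "v \<bullet> extend_by_zero B g = weighted_variation a v"
    using assms(1,2) voltage_potentials_iff by metis
  have "0 \<le> weighted_variation a v"
    using inner_divergence_le[OF J, of v] inner_divergence_le[OF J, of "- v"]
      weighted_variation_scale[of a "- 1" v] by simp
  moreover have one: "c * weighted_variation a v = 1" using feas eq by simp
  ultimately have "0 < c" by (metis mult_nonpos_nonneg not_le zero_less_one)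
  with one have "weighted_variation a (c *\<^sub>R v) = 1" by (simp add: weighted_variation_scale)
  moreover have "1 \<le> weighted_variation a u" if "u \<bullet> extend_by_zero B g = 1" for u
    using inner_divergence_le[OF J, of u] div that by simp
  ultimately show ?thesis using feas by (simp add: least_gradient_minimizer_iff)
qed

text \<open>
  The minimal energy is the Lagrange multiplier of the constraint \<open>u \<bullet> g = 1\<close>, because the
  energy is homogeneous of degree one; this is why it is the factor multiplying the injected
  current.
\<close>

lemma minimizer_is_voltage_potential:
  assumes a: "measurement_matrix E a" and v: "least_gradient_minimizer B g a v"
  shows "v \<in> voltage_potentials E B (\<lambda>i. weighted_variation a v * g i) a"
proof -
  let ?m = "weighted_variation a v" and ?g = "extend_by_zero B g"
  have sym: "a $ i $ j = a $ j $ i" and nonneg: "0 \<le> a $ i $ j" for i j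
    using a unfolding measurement_matrix_def by blast+
  have energy_nonneg: "0 \<le> weighted_variation a u" for u
    by (simp add: weighted_variation_def sum_nonneg nonneg)
  have "u \<bullet> (?m *\<^sub>R ?g) \<le> weighted_variation a u" for u
  proof (cases "0 < u \<bullet> ?g")
    case True
    then have "?m \<le> weighted_variation a ((1 / (u \<bullet> ?g)) *\<^sub>R u)"
      using v by (simp add: least_gradient_minimizer_iff)
    with True show ?thesis by (simp add: weighted_variation_scale field_simps)
  next
    case False
    then have "u \<bullet> (?m *\<^sub>R ?g) \<le> 0"
      using energy_nonneg[of v] by (simp add: mult_nonneg_nonpos)
    then show ?thesis using energy_nonneg[of u] by simp
  qed
  then obtain J where J: "J \<in> admissible_flows a" and div: "divergence J = ?m *\<^sub>R ?g"
    using divergence_of_admissible_flow_iff[OF sym nonneg] by (metis imageE)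
  have "v \<bullet> divergence J = ?m"
    using v div by (simp add: least_gradient_minimizer_iff)
  then show ?thesis
    using J div by (auto simp: voltage_potentials_iff[OF a] extend_by_zero_scale)
qed

theorem theorem3p7:
  fixes E :: "'n::finite set set" and B :: "'n set"
    and g :: "'n \<Rightarrow> real" and a :: "real^'n^'n"
  assumes "simple_connected_graph E"
    and "measurement_matrix E a"
    and "(\<Sum>i\<in>B. g i) = 0"
  shows "((\<exists>i\<in>B. g i \<noteq> 0) \<longrightarrow>
           (\<forall>v \<in> voltage_potentials E B g a. \<forall>c::real.
              c *\<^sub>R v \<in> feasible_potentials B g \<longrightarrow> least_gradient_minimizer B g a (c *\<^sub>R v))) \<and>
         (\<forall>v. least_gradient_minimizer B g a v \<longrightarrow> 0 < weighted_variation a v \<longrightarrow>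
              (\<exists>l>0. v \<in> voltage_potentials E B (\<lambda>i. l * g i) a))"
  using minimizer_is_voltage_potential[OF assms(2)]
    normalized_voltage_potential_is_minimizer[OF assms(2)]
  by (auto simp: feasible_potentials_def inner_extend_by_zero simp del: inner_scaleR_left)

end
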